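(* Let $P$ be a $d$-polytope with the $V(P)$-pointed triangulation $\mathcal{C}_P$, and for $k\in\{0,1,\ldots,d\}$ let $d_k$ be the number of $k$-simplexes in $\mathcal{C}_P$. Then the $V(P)$-polytope numbers are represented by $$P(n)=\sum_{k=0}^{d}d_k\,\alpha^k\big(n-(k+1)\big).$$
   Context: A $d$-polytope is a $d$-dimensional convex hull of finitely many points in some $\mathbb{R}^e$. Pointed triangulation: let $\mathbf{c}\mathbf{x}$ be a linear function taking distinct values at distinct vertexes of $P$. For each nonempty face $F$ of $P$ (including $P$) let the apex $\mathbf{v}_F$ be the unique vertex of $F$ at which $\mathbf{c}\mathbf{x}$ attains its minimum on $F$; $V(P)$ denotes this system of apexes. The $V(P)$-pointed triangulation of $P$ is $$\mathcal{C}_P=\{\emptyset\}\cup\big\{conv(\{\mathbf{v}_{G_1},\ldots,\mathbf{v}_{G_k}\}) : 1\le k\le d+1,\ G_1\supsetneq\cdots\supsetneq G_k \text{ nonempty faces of } P,\ \mathbf{v}_{G_i}\notin G_{i+1}\ (1\le i<k)\big\},$$ which is a triangulation of $P$. Polytope numbers: let $\mathcal{F}(P)$ be the set of nonempty faces of $P$, including $P$. With the apexes above, the $V(P)$-polytope numbers $P(n)$ and interior polytope numbers $P(n)^\sharp$ are defined by double induction on $d=\dim P$ and $n\ge0$ (each face is a polytope with the inherited apexes): if $d=0$, $P(0)=P(0)^\sharp=0$ and $P(n)=P(n)^\sharp=1$ for $n\ge1$; if $d\ge1$, $P(0)=0$, $P(1)=1$, $P(0)^\sharp=P(1)^\sharp=0$,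 and for $n\ge2$ $$P(n)=P(n-1)+\sum_{F\in\mathcal{F}(P),\ \mathbf{v}_P\notin F}F(n)^\sharp,\qquad P(n)^\sharp=P(n)-\sum_{F\in\mathcal{F}(P)\setminus\{P\}}F(n)^\sharp .$$ $\alpha^k(m)$ denotes the polytope numbers of a $k$-simplex; explicitly $\alpha^k(m)=\binom{m+k-1}{k}$ for $m\ge1$ and $\alpha^k(m)=0$ for $m\le0$ (also for $k=0$).
   Formalization: The formula is proved for all n ≥ 0 except n = 1: there P(1) = 1 for every polytope, while all α^k(1−(k+1)) = α^k(−k) are 0 by the stated convention (also for k = 0), so the formula fails at n = 1. *)

theory Defs
  imports "HOL-Analysis.Analysis"
begin

definition nonempty_faces :: "'a::euclidean_space set \<Rightarrow> 'a set set" where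
  "nonempty_faces P = {F. F face_of P \<and> F \<noteq> {}}"

text \<open>
  The linear function is \<open>\<lambda>x. c \<bullet> x\<close>; the vertices of a polytope are its extreme points.
\<close>

definition separates_vertices :: "'a::euclidean_space \<Rightarrow> 'a set \<Rightarrow> bool" where
  "separates_vertices c P \<longleftrightarrow> inj_on (\<lambda>v. c \<bullet> v) {v. v extreme_point_of P}"

definition apex :: "'a::euclidean_space \<Rightarrow> 'a set \<Rightarrow> 'a" where
  "apex c F = (THE v. v extreme_point_of F \<and> (\<forall>x\<in>F. c \<bullet> v \<le> c \<bullet> x))"

text \<open>
  A chain of faces \<open>G\<^sub>1 \<supset> \<dots> \<supset> G\<^sub>k\<close> is the list \<open>[G\<^sub>1, \<dots>, G\<^sub>k]\<close>, indexed from \<open>0\<close>.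
\<close>

definition pointed_chain :: "'a::euclidean_space \<Rightarrow> 'a set \<Rightarrow> 'a set list \<Rightarrow> bool" where
  "pointed_chain c P Gs \<longleftrightarrow>
     set Gs \<subseteq> nonempty_faces P \<and>
     (\<forall>i. Suc i < length Gs \<longrightarrow> Gs ! Suc i \<subset> Gs ! i \<and> apex c (Gs ! i) \<notin> Gs ! Suc i)"

definition pointed_triangulation :: "'a::euclidean_space \<Rightarrow> 'a set \<Rightarrow> 'a set set" where
  "pointed_triangulation c P =
     {{}} \<union> {convex hull (apex c ` set Gs) | Gs.
              1 \<le> length Gs \<and> int (length Gs) \<le> aff_dim P + 1 \<and> pointed_chain c P Gs}"

definition num_simplexes :: "'a::euclidean_space \<Rightarrow> 'a set \<Rightarrow> nat \<Rightarrow> nat" where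
  "num_simplexes c P k = card {S \<in> pointed_triangulation c P. int k simplex S}"

text \<open>Existence and uniqueness of the apex, needed for the recursion below.\<close>

lemma apex_works:
  fixes P :: "'a::euclidean_space set"
  assumes P: "polytope P" "P \<noteq> {}" and c: "separates_vertices c P"
  shows "apex c P extreme_point_of P \<and> (\<forall>x\<in>P. c \<bullet> apex c P \<le> c \<bullet> x)"
  unfolding apex_def
proof (rule theI')
  let ?V = "{v. v extreme_point_of P}"
  have hull: "P = convex hull ?V"
    using P by (intro Krein_Milman_Minkowski polytope_imp_compact polytope_imp_convex)
  have fin: "finite ?V"
    using P by (simp add: finite_polyhedron_extreme_points polytope_imp_polyhedron)
  have ne: "?V \<noteq> {}"
    using hull P(2) by (metis convex_hull_empty)
  obtain v where v: "v \<in> ?V" "\<And>w. w \<in> ?V \<Longrightarrow> c \<bullet> v \<le> c \<bullet> w"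
    using ex_is_arg_min_if_finite[OF fin ne, of "\<lambda>v. c \<bullet> v"]
    by (auto simp: is_arg_min_linorder)
  have "convex hull ?V \<subseteq> {x. c \<bullet> v \<le> c \<bullet> x}"
    using v(2) convex_halfspace_ge[of "c \<bullet> v" c] by (intro hull_minimal) auto
  hence min: "\<forall>x\<in>P. c \<bullet> v \<le> c \<bullet> x"
    using hull by auto
  show "\<exists>!v. v extreme_point_of P \<and> (\<forall>x\<in>P. c \<bullet> v \<le> c \<bullet> x)"
  proof (rule ex1I[of _ v])
    show "v extreme_point_of P \<and> (\<forall>x\<in>P. c \<bullet> v \<le> c \<bullet> x)"
      using v(1) min by simp
  next
    fix w assume w: "w extreme_point_of P \<and> (\<forall>x\<in>P. c \<bullet> w \<le> c \<bullet> x)"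
    have "v \<in> P" "w \<in> P"
      using v(1) w by (auto simp: extreme_point_of_def)
    hence "c \<bullet> w = c \<bullet> v"
      using w min by (meson order_antisym)
    thus "w = v"
      using c v(1) w by (auto simp: separates_vertices_def inj_on_def)
  qed
qed

lemma apex_in:
  fixes P :: "'a::euclidean_space set"
  assumes "polytope P" "P \<noteq> {}" "separates_vertices c P"
  shows "apex c P \<in> P"
  using apex_works[OF assms] by (auto simp: extreme_point_of_def)

text \<open>
  The two mutually recursive functions are only meant for nonempty polytopes \<open>P\<close> on which \<open>c\<close>
  separates the vertices; all nonempty faces of such a \<open>P\<close> have the same property.  The junk
  value \<open>0\<close> elsewhere makes the recursion total.
\<close>

definition apex_polytope :: "'a::euclidean_space \<Rightarrow> 'a set \<Rightarrow> bool" where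
  "apex_polytope c P \<longleftrightarrow> polytope P \<and> P \<noteq> {} \<and> separates_vertices c P"

lemma apex_polytope_face:
  fixes P :: "'a::euclidean_space set"
  assumes "apex_polytope c P" "F \<in> nonempty_faces P"
  shows "apex_polytope c F"
proof -
  have "{v. v extreme_point_of F} \<subseteq> {v. v extreme_point_of P}"
    using assms(2) extreme_point_of_face[of F P] by (auto simp: nonempty_faces_def)
  thus ?thesis
    using assms face_of_polytope_polytope[of P F] inj_on_subset
    unfolding apex_polytope_def nonempty_faces_def separates_vertices_def by blast
qed

lemma nat_aff_dim_face_less:
  fixes P :: "'a::euclidean_space set"
  assumes "apex_polytope c P" "F \<in> nonempty_faces P" "F \<noteq> P"
  shows "nat (aff_dim F) < nat (aff_dim P)"
proof -
  have "aff_dim F < aff_dim P"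
    using assms face_of_aff_dim_lt[of P F] polytope_imp_convex
    by (auto simp: apex_polytope_def nonempty_faces_def)
  moreover have "aff_dim F \<ge> 0"
    using assms(2) aff_dim_geq[of F] aff_dim_empty[of F] by (simp add: nonempty_faces_def)
  ultimately show ?thesis by linarith
qed

function polytope_number :: "'a::euclidean_space \<Rightarrow> 'a set \<Rightarrow> nat \<Rightarrow> int"
  and interior_polytope_number :: "'a::euclidean_space \<Rightarrow> 'a set \<Rightarrow> nat \<Rightarrow> int" where
  "polytope_number c P n =
     (if \<not> apex_polytope c P then 0
      else if aff_dim P = 0 then (if n = 0 then 0 else 1)
      else if n = 0 then 0
      else if n = 1 then 1
      else polytope_number c P (n - 1)
           + (\<Sum>F \<in> {F \<in> nonempty_faces P. apex c P \<notin> F}. interior_polytope_number c F n))"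
| "interior_polytope_number c P n =
     (if \<not> apex_polytope c P then 0
      else if aff_dim P = 0 then (if n = 0 then 0 else 1)
      else if n = 0 \<or> n = 1 then 0
      else polytope_number c P n
           - (\<Sum>F \<in> nonempty_faces P - {P}. interior_polytope_number c F n))"
  by pat_completeness auto
termination
proof (relation "inv_image (less_than <*lex*> less_than <*lex*> less_than)
     (case_sum (\<lambda>(c, P, n). (nat (aff_dim P), n, 0::nat)) (\<lambda>(c, P, n). (nat (aff_dim P), n, 1)))",
    goal_cases)
  case 1
  show ?case by (intro wf_inv_image wf_lex_prod wf_less_than)
next
  case (3 c P n F)
  hence "F \<noteq> P" using apex_in by (auto simp: apex_polytope_def)
  thus ?case using 3 nat_aff_dim_face_less[of c P F] by simp
next
  case (5 c P n F)
  thus ?case using nat_aff_dim_face_less[of c P F] by simp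
qed auto

declare polytope_number.simps [simp del] interior_polytope_number.simps [simp del]

text \<open>
  The argument is an integer, as \<open>\<alpha>\<^sup>k\<close> is evaluated at possibly negative numbers, where it is
  \<open>0\<close>.  In particular \<open>simplex_number 0 0 = 0\<close>, so that the sum
  \<open>\<Sum>k\<le>d. d\<^sub>k * \<alpha>\<^sup>k (n - (k + 1))\<close> is \<open>0\<close> for \<open>n = 1\<close>, whereas the polytope number is \<open>1\<close> there.
\<close>

definition simplex_number :: "nat \<Rightarrow> int \<Rightarrow> int" where
  "simplex_number k m = (if m \<ge> 1 then int (nat (m + int k - 1) choose k) else 0)"

end

theory Submission
  imports Defs
begin

text \<open>
  Write \<open>v\<^sub>P\<close> for the apex of \<open>P\<close>.  Each simplex of the triangulation lies in a unique smallest face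
  of \<open>P\<close>; it belongs to the triangulation of that face and contains its apex, so the smallest face
  contains \<open>v\<^sub>P\<close> if and only if the simplex does.  Hence the simplexes without the vertex \<open>v\<^sub>P\<close> are the
  interior simplexes of the faces that avoid \<open>v\<^sub>P\<close>, and adding \<open>v\<^sub>P\<close> to them (or to the empty set)
  yields all the others.  With \<open>n = m + 2\<close>, \<open>\<alpha>\<^sup>k (n - (k + 1))\<close> is \<open>m choose k\<close>, and Pascal's rule
  turns this pyramid structure into the recursion for \<open>P(n)\<close>, while splitting the simplexes
  according to their smallest faces gives the recursion for \<open>P(n)\<^sup>\<sharp>\<close>.
\<close>

section \<open>Apexes and faces\<close>

lemma apex_mem:
  "apex_polytope c P \<Longrightarrow> apex c P \<in> P"
  by (simp add: apex_in apex_polytope_def)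

lemma apex_polytope_convex:
  "apex_polytope c P \<Longrightarrow> convex P"
  by (simp add: apex_polytope_def polytope_imp_convex)

lemma apex_polytope_self_face:
  "apex_polytope c P \<Longrightarrow> P \<in> nonempty_faces P"
  by (simp add: apex_polytope_def nonempty_faces_def polytope_imp_convex face_of_refl)

lemma finite_nonempty_faces:
  "apex_polytope c P \<Longrightarrow> finite (nonempty_faces P)"
  unfolding apex_polytope_def nonempty_faces_def
  by (rule finite_subset[OF _ finite_polytope_faces[of P]]) auto

text \<open>Both points are vertices of \<open>P\<close> minimizing \<open>c\<close> over
  \<open>F\<close>, so separation of the vertices identifies them.\<close>

lemma apex_face_eq:
  assumes "apex_polytope c P" "F face_of P" "apex c P \<in> F"
  shows "apex c F = apex c P"
proof -
  have F: "apex_polytope c F" "F \<subseteq> P"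
    using apex_polytope_face[OF assms(1), of F] face_of_imp_subset[OF assms(2)] assms(2,3)
    by (auto simp: nonempty_faces_def)
  have p: "apex c P extreme_point_of P" "\<forall>x\<in>P. c \<bullet> apex c P \<le> c \<bullet> x"
    using assms(1) apex_works by (auto simp: apex_polytope_def)
  have f: "apex c F extreme_point_of P" "\<forall>x\<in>F. c \<bullet> apex c F \<le> c \<bullet> x"
    using F(1) apex_works extreme_point_of_face[OF assms(2)] by (auto simp: apex_polytope_def)
  have "c \<bullet> apex c F = c \<bullet> apex c P"
    using f p assms(3) F apex_mem by (meson order_antisym subsetD)
  thus ?thesis
    using p f assms(1) by (auto simp: apex_polytope_def separates_vertices_def inj_on_def)
qed

section \<open>Vertex sets of the simplexes\<close>

text \<open>
  A simplex of the triangulation is represented by its vertex set.  Here \<open>G\<close> is the first face of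
  the chain and \<open>H\<close> is any face of \<open>G\<close> that contains the second one.
\<close>

inductive apex_simplex :: "'a::euclidean_space \<Rightarrow> 'a set \<Rightarrow> 'a set \<Rightarrow> bool" for c where
  empty: "apex_simplex c P {}"
| insert: "\<lbrakk>apex_polytope c G; G face_of P; H face_of G; apex c G \<notin> H; apex_simplex c H W\<rbrakk>
    \<Longrightarrow> apex_simplex c P (insert (apex c G) W)"

lemma apex_simplex_subset:
  "apex_simplex c P W \<Longrightarrow> W \<subseteq> P"
proof (induction rule: apex_simplex.induct)
  case (insert G P H W)
  have "apex c G \<in> G" "G \<subseteq> P" "H \<subseteq> G"
    using insert.hyps(1-3) by (simp_all add: apex_mem face_of_imp_subset)
  thus ?case using insert.IH by blast
qed simp

text \<open>Only the first face of the chain is tied to the ambient set, so transitivity of faces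
  suffices.\<close>

lemma apex_simplex_face_mono:
  assumes "apex_simplex c F W" "F face_of P"
  shows "apex_simplex c P W"
  using assms(1)
proof cases
  case (insert G H W')
  have "G face_of P" using insert(3) assms(2) by (rule face_of_trans)
  thus ?thesis unfolding insert(1) using insert(2,4-6) by (blast intro: apex_simplex.insert)
qed (simp add: apex_simplex.empty)

text \<open>Intersect every face of the chain with \<open>F\<close>: the apex of \<open>G\<close>
  lies in \<open>F\<close>, so it is also the apex of \<open>G \<inter> F\<close>.\<close>

lemma apex_simplex_restrict:
  "apex_simplex c P W \<Longrightarrow> F face_of P \<Longrightarrow> W \<subseteq> F \<Longrightarrow> apex_simplex c F W"
proof (induction arbitrary: F rule: apex_simplex.induct)
  case (insert G P H W)
  have aG: "apex c G \<in> G" using apex_mem insert.hyps(1) .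
  have GF: "G \<inter> F face_of P" using insert.hyps(2) insert.prems(1) by (rule face_of_Int)
  have GF1: "G \<inter> F face_of G" "G \<inter> F face_of F"
    using GF by (simp_all add: face_of_face[OF insert.hyps(2)] face_of_face[OF insert.prems(1)])
  have eq: "apex c (G \<inter> F) = apex c G"
    using apex_face_eq[OF insert.hyps(1) GF1(1)] aG insert.prems(2) by auto
  have HG: "H \<subseteq> G" "H face_of P"
    using face_of_imp_subset[OF insert.hyps(3)] face_of_trans[OF insert.hyps(3,2)] by blast+
  have HF: "H \<inter> F face_of P"
    using HG(2) insert.prems(1) by (rule face_of_Int)
  have "apex_simplex c F (insert (apex c (G \<inter> F)) W)"
  proof (rule apex_simplex.insert)
    show "apex_polytope c (G \<inter> F)"
      using apex_polytope_face[OF insert.hyps(1), of "G \<inter> F"] GF1 aG insert.prems(2)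
      by (auto simp: nonempty_faces_def)
    show "G \<inter> F face_of F" by (fact GF1)
    show "H \<inter> F face_of G \<inter> F"
      using HF HG(1) by (auto simp: face_of_face[OF GF])
    show "apex c (G \<inter> F) \<notin> H \<inter> F"
      using eq insert.hyps(4) by auto
    have "H \<inter> F face_of H" using HF by (simp add: face_of_face[OF HG(2)])
    moreover have "W \<subseteq> H \<inter> F"
      using apex_simplex_subset[OF insert.hyps(5)] insert.prems(2) by auto
    ultimately show "apex_simplex c (H \<inter> F) W" by (rule insert.IH)
  qed
  thus ?case by (simp add: eq)
qed (rule apex_simplex.empty)

text \<open>A face \<open>H\<close> of the convex set \<open>G\<close> is cut out of
  \<open>G\<close> by its affine hull. An apex outside \<open>H\<close> is thus outside this hull,
  which contains that of \<open>W\<close>.\<close>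

lemma apex_simplex_affine_independent:
  "apex_simplex c P W \<Longrightarrow> \<not> affine_dependent W"
proof (induction rule: apex_simplex.induct)
  case (insert G P H W)
  have "H = affine hull H \<inter> G"
    using apex_polytope_convex[OF insert.hyps(1)] insert.hyps(3) by (rule face_of_imp_eq_affine_Int)
  hence "apex c G \<notin> affine hull H"
    using insert.hyps(4) apex_mem[OF insert.hyps(1)] by blast
  moreover have "affine hull W \<subseteq> affine hull H"
    using apex_simplex_subset[OF insert.hyps(5)] by (rule hull_mono)
  ultimately show ?case
    using affine_independent_insert insert.IH by blast
qed simp

text \<open>The chain for \<open>W\<close> restricts to \<open>F\<close>, and \<open>P\<close> can
  then be put in front of it.\<close>

lemma apex_simplex_insert_apex:
  assumes "apex_polytope c P" "apex_simplex c P W" "F face_of P" "W \<subseteq> F" "apex c P \<notin> F"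
  shows "apex_simplex c P (insert (apex c P) W)"
proof (rule apex_simplex.insert)
  show "P face_of P" using assms(1) by (intro face_of_refl apex_polytope_convex)
  show "apex_simplex c F W" using assms(2-4) by (rule apex_simplex_restrict)
qed (use assms in auto)

text \<open>The first face \<open>G\<close> contains all of \<open>W\<close>, hence the apex of
  \<open>P\<close>, which is therefore the apex of \<open>G\<close>; removing it leaves the tail of
  the chain.\<close>

lemma apex_simplex_remove_apex:
  assumes "apex_polytope c P" "apex_simplex c P W" "apex c P \<in> W"
  shows "apex_simplex c P (W - {apex c P})"
  using assms(2)
proof cases
  case (insert G H W')
  have "W' \<subseteq> H" "H \<subseteq> G"
    using insert(4,6) by (simp_all add: apex_simplex_subset face_of_imp_subset)
  hence "apex c P \<in> G" using insert(1) assms(3) apex_mem[OF insert(2)] by auto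
  with assms(1) insert(3) have "apex c G = apex c P" by (rule apex_face_eq)
  hence "W - {apex c P} = W'" using insert(1,5) \<open>W' \<subseteq> H\<close> by auto
  moreover have "H face_of P" using insert(4,3) by (rule face_of_trans)
  ultimately show ?thesis using apex_simplex_face_mono[OF insert(6)] by simp
qed (use assms in auto)

section \<open>Smallest faces and interior simplexes\<close>

text \<open>Intrinsic to \<open>F\<close>: whenever \<open>F\<close> is a face of a polytope
  \<open>P\<close>, this makes \<open>F\<close> the smallest face of \<open>P\<close> containing
  \<open>W\<close>.\<close>

definition minimal_face_over :: "'a::euclidean_space set \<Rightarrow> 'a set \<Rightarrow> bool" where
  "minimal_face_over F W \<longleftrightarrow> W \<subseteq> F \<and> (\<forall>H. H face_of F \<longrightarrow> W \<subseteq> H \<longrightarrow> H = F)"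

text \<open>The empty simplex is left out, so \<open>card W - 1\<close> is the dimension.\<close>

definition simplexes :: "'a::euclidean_space \<Rightarrow> 'a set \<Rightarrow> 'a set set" where
  "simplexes c P = {W. apex_simplex c P W \<and> W \<noteq> {}}"

definition interior_simplexes :: "'a::euclidean_space \<Rightarrow> 'a set \<Rightarrow> 'a set set" where
  "interior_simplexes c P = {W \<in> simplexes c P. minimal_face_over P W}"

text \<open>Take the intersection of all faces containing \<open>W\<close>; convexity makes
  \<open>P\<close> one of them.\<close>

lemma minimal_face_exists:
  assumes "convex P" "W \<subseteq> P" "W \<noteq> {}"
  obtains F where "F \<in> nonempty_faces P" "minimal_face_over F W"
proof
  let ?A = "{F. F face_of P \<and> W \<subseteq> F}"
  have ne: "?A \<noteq> {}" using assms face_of_refl by auto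
  have face: "\<Inter> ?A face_of P" using ne by (rule face_of_Inter) auto
  have W: "W \<subseteq> \<Inter> ?A" by auto
  show "\<Inter> ?A \<in> nonempty_faces P"
    using face W assms(3) unfolding nonempty_faces_def by blast
  show "minimal_face_over (\<Inter> ?A) W"
    unfolding minimal_face_over_def
  proof (intro conjI allI impI W)
    fix H assume H: "H face_of \<Inter> ?A" "W \<subseteq> H"
    hence "H \<in> ?A" using face face_of_trans by blast
    thus "H = \<Inter> ?A" using face_of_imp_subset[OF H(1)] by blast
  qed
qed

text \<open>\<open>F \<inter> G\<close> is a face of both and contains \<open>W\<close>, so it
  equals both.\<close>

lemma minimal_face_unique:
  assumes "F face_of P" "G face_of P" "minimal_face_over F W" "minimal_face_over G W"
  shows "F = G"
proof -
  have "F \<inter> G face_of F" "F \<inter> G face_of G"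
    using face_of_Int[OF assms(1,2)] face_of_face assms(1,2) by blast+
  thus ?thesis
    using assms(3,4) unfolding minimal_face_over_def by (metis le_inf_iff)
qed

text \<open>The first face of the chain contains \<open>W\<close>, so by minimality it is
  \<open>F\<close> itself.\<close>

lemma apex_minimal_face:
  assumes "apex_simplex c F W" "W \<noteq> {}" "minimal_face_over F W"
  shows "apex c F \<in> W"
  using assms(1)
proof cases
  case (insert G H W')
  have "W \<subseteq> G"
    using apex_mem[OF insert(2)] apex_simplex_subset[OF insert(6)] face_of_imp_subset[OF insert(4)]
    by (auto simp: insert(1))
  hence "G = F" using insert(3) assms(3) by (simp add: minimal_face_over_def)
  thus ?thesis using insert(1) by simp
qed (use assms in auto)

text \<open>If \<open>F\<close> contains the apex of \<open>P\<close>, that point is the apex of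
  \<open>F\<close>, which belongs to \<open>W\<close> by minimality.\<close>

lemma apex_minimal_face_mem_iff:
  assumes "apex_polytope c P" "apex_simplex c P W" "W \<noteq> {}" "F face_of P" "minimal_face_over F W"
  shows "apex c P \<in> F \<longleftrightarrow> apex c P \<in> W"
proof
  assume "apex c P \<in> F"
  with assms(1,4) have "apex c F = apex c P" by (rule apex_face_eq)
  moreover have "apex_simplex c F W"
    using assms(2,4,5) by (intro apex_simplex_restrict[of c P W F]) (simp_all add: minimal_face_over_def)
  ultimately show "apex c P \<in> W" using apex_minimal_face[of c F W] assms(3,5) by simp
qed (use assms in \<open>auto simp: minimal_face_over_def\<close>)

lemma simplexes_eq_Union_interior:
  assumes "apex_polytope c P"
  shows "simplexes c P = (\<Union>F\<in>nonempty_faces P. interior_simplexes c F)" (is "?L = ?R")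
proof
  show "?L \<subseteq> ?R"
  proof
    fix W assume W: "W \<in> ?L"
    then obtain F where F: "F \<in> nonempty_faces P" "minimal_face_over F W"
      using minimal_face_exists[of P W] apex_polytope_convex[OF assms] apex_simplex_subset
      unfolding simplexes_def by blast
    hence "apex_simplex c F W"
      using W apex_simplex_restrict
      unfolding simplexes_def nonempty_faces_def minimal_face_over_def by blast
    thus "W \<in> ?R" using F W unfolding simplexes_def interior_simplexes_def by blast
  qed
  show "?R \<subseteq> ?L"
    unfolding simplexes_def interior_simplexes_def nonempty_faces_def
    using apex_simplex_face_mono by blast
qed

text \<open>The faces on the right are those summed over in the recursion for
  \<open>polytope_number\<close>.\<close>

lemma simplexes_avoiding_apex_eq_Union_interior:
  assumes "apex_polytope c P"
  shows "{W \<in> simplexes c P. apex c P \<notin> W} =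
    (\<Union>F\<in>{F \<in> nonempty_faces P. apex c P \<notin> F}. interior_simplexes c F)"
proof -
  have "apex c P \<in> F \<longleftrightarrow> apex c P \<in> W"
    if "F \<in> nonempty_faces P" "W \<in> interior_simplexes c F" for F W
    using that apex_minimal_face_mem_iff[OF assms, of W F] apex_simplex_face_mono
    unfolding nonempty_faces_def interior_simplexes_def simplexes_def by blast
  thus ?thesis unfolding simplexes_eq_Union_interior[OF assms] by blast
qed

lemma interior_simplexes_disjoint:
  assumes "F \<in> nonempty_faces P" "G \<in> nonempty_faces P" "F \<noteq> G"
  shows "interior_simplexes c F \<inter> interior_simplexes c G = {}"
  using assms minimal_face_unique unfolding nonempty_faces_def interior_simplexes_def by blast

section \<open>Finiteness and the pyramid over the apex\<close>

lemma apex_simplex_extreme_points: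
  "apex_simplex c P W \<Longrightarrow> W \<subseteq> {v. v extreme_point_of P}"
proof (induction rule: apex_simplex.induct)
  case (insert G P H W)
  have "apex c G extreme_point_of G"
    using insert.hyps(1) apex_works by (auto simp: apex_polytope_def)
  moreover have "H face_of P"
    using insert.hyps face_of_trans by blast
  ultimately show ?case
    using insert.IH insert.hyps(2) extreme_point_of_face by fastforce
qed simp

lemma finite_simplexes:
  assumes "apex_polytope c P"
  shows "finite (simplexes c P)"
proof (rule finite_subset)
  show "simplexes c P \<subseteq> Pow {v. v extreme_point_of P}"
    using apex_simplex_extreme_points unfolding simplexes_def by blast
  show "finite (Pow {v. v extreme_point_of P})"
    using assms by (simp add: apex_polytope_def finite_polyhedron_extreme_points polytope_imp_polyhedron)
qed

lemma finite_simplex_set: "W \<in> simplexes c P \<Longrightarrow> finite W"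
  unfolding simplexes_def using apex_simplex_affine_independent aff_independent_finite by blast

lemma card_simplex_pos: "W \<in> simplexes c P \<Longrightarrow> 0 < card W"
  using finite_simplex_set[of W c P] by (simp add: card_gt_0_iff simplexes_def)

text \<open>Removing the apex keeps a simplex in the triangulation. Conversely, one without the apex
  lies in a face avoiding the apex, so the apex can be added.\<close>

lemma simplexes_pyramid:
  fixes c :: "'a::euclidean_space"
  assumes P: "apex_polytope c P"
  defines "A \<equiv> {W \<in> simplexes c P. apex c P \<notin> W}"
  shows "simplexes c P = A \<union> insert (apex c P) ` (insert {} A)" (is "_ = ?R")
proof
  show "simplexes c P \<subseteq> ?R"
  proof
    fix W assume W: "W \<in> simplexes c P"
    have "W - {apex c P} \<in> insert {} A" if "apex c P \<in> W"
      using that W apex_simplex_remove_apex[OF P] by (auto simp: A_def simplexes_def)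
    thus "W \<in> ?R" using W A_def by (cases "apex c P \<in> W") (auto simp: image_iff intro: insert_Diff[symmetric])
  qed
  have "insert (apex c P) W \<in> simplexes c P" if W: "W \<in> insert {} A" for W
  proof -
    \<comment> \<open>For empty \<open>W\<close> the empty face serves.\<close>
    have "\<exists>F. F face_of P \<and> W \<subseteq> F \<and> apex c P \<notin> F"
    proof (cases "W = {}")
      case False
      then obtain F where "F \<in> nonempty_faces P" "apex c P \<notin> F" "W \<in> interior_simplexes c F"
        using W simplexes_avoiding_apex_eq_Union_interior[OF P] unfolding A_def by auto
      thus ?thesis
        unfolding nonempty_faces_def interior_simplexes_def minimal_face_over_def by blast
    qed auto
    moreover have "apex_simplex c P W"
      using W by (auto simp: A_def simplexes_def intro: apex_simplex.empty)
    ultimately show ?thesis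
      using apex_simplex_insert_apex[OF P] unfolding simplexes_def by blast
  qed
  thus "?R \<subseteq> simplexes c P" unfolding A_def by auto
qed

lemma sum_simplexes_pyramid:
  fixes c :: "'a::euclidean_space"
  assumes P: "apex_polytope c P"
  defines "A \<equiv> {W \<in> simplexes c P. apex c P \<notin> W}"
  shows "(\<Sum>W\<in>simplexes c P. int (m choose (card W - 1))) = 1 + (\<Sum>W\<in>A. int (Suc m choose card W))"
proof -
  have finA: "finite A" using finite_simplexes[OF P] A_def by simp
  have A: "finite W" "W \<noteq> {}" "apex c P \<notin> W" if "W \<in> A" for W
    using that finite_simplex_set unfolding A_def simplexes_def by blast+
  have inj: "inj_on (insert (apex c P)) (insert {} A)"
  proof (rule inj_onI)
    fix V W assume "V \<in> insert {} A" "W \<in> insert {} A"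
      and eq: "insert (apex c P) V = insert (apex c P) W"
    hence "apex c P \<notin> V" "apex c P \<notin> W" using A(3) by auto
    thus "V = W" using eq by (simp add: insert_ident)
  qed
  have "(\<Sum>W\<in>simplexes c P. int (m choose (card W - 1))) =
      (\<Sum>W\<in>A. int (m choose (card W - 1)))
      + (\<Sum>W\<in>insert (apex c P) ` insert {} A. int (m choose (card W - 1)))"
    unfolding simplexes_pyramid[OF P, folded A_def]
    by (rule sum.union_disjoint) (use finA A in auto)
  \<comment> \<open>Adding the apex raises the cardinality by one, which cancels the
    \<open>- 1\<close>.\<close>
  also have "(\<Sum>W\<in>insert (apex c P) ` insert {} A. int (m choose (card W - 1))) =
      (\<Sum>W\<in>insert {} A. int (m choose card W))"
    unfolding sum.reindex[OF inj] o_def by (rule sum.cong) (use A in auto)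
  \<comment> \<open>The empty base, that is the simplex consisting of the apex alone, contributes
    \<open>m choose 0 = 1\<close>.\<close>
  also have "\<dots> = 1 + (\<Sum>W\<in>A. int (m choose card W))"
    using finA A by (subst sum.insert) auto
  also have "(\<Sum>W\<in>A. int (m choose (card W - 1))) + (1 + (\<Sum>W\<in>A. int (m choose card W))) =
      1 + (\<Sum>W\<in>A. int (m choose (card W - 1)) + int (m choose card W))"
    by (simp add: sum.distrib)
  also have "(\<Sum>W\<in>A. int (m choose (card W - 1)) + int (m choose card W)) =
      (\<Sum>W\<in>A. int (Suc m choose card W))"
  \<comment> \<open>Pascal's rule applies because \<open>card W\<close> is positive.\<close>
  proof (rule sum.cong)
    fix W assume "W \<in> A"
    hence "0 < card W" unfolding A_def using card_simplex_pos by auto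
    then obtain k where "card W = Suc k" using gr0_implies_Suc by blast
    thus "int (m choose (card W - 1)) + int (m choose card W) = int (Suc m choose card W)" by simp
  qed simp
  finally show ?thesis .
qed

section \<open>Polytope numbers as sums over simplexes\<close>

lemma sum_simplexes_eq_sum_faces:
  fixes f :: "'a::euclidean_space set \<Rightarrow> int"
  assumes P: "apex_polytope c P"
  shows "sum f (simplexes c P) = (\<Sum>F\<in>nonempty_faces P. sum f (interior_simplexes c F))"
    and "sum f {W \<in> simplexes c P. apex c P \<notin> W} =
      (\<Sum>F\<in>{F \<in> nonempty_faces P. apex c P \<notin> F}. sum f (interior_simplexes c F))"
proof -
  have fin: "\<forall>F\<in>nonempty_faces P. finite (interior_simplexes c F)"
    by (simp add: interior_simplexes_def finite_simplexes[OF apex_polytope_face[OF P]])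
  have disj: "\<forall>F\<in>nonempty_faces P. \<forall>G\<in>nonempty_faces P.
      F \<noteq> G \<longrightarrow> interior_simplexes c F \<inter> interior_simplexes c G = {}"
    by (simp add: interior_simplexes_disjoint)
  show "sum f (simplexes c P) = (\<Sum>F\<in>nonempty_faces P. sum f (interior_simplexes c F))"
    unfolding simplexes_eq_Union_interior[OF P]
    by (rule sum.UNION_disjoint[OF finite_nonempty_faces[OF P] fin disj])
  show "sum f {W \<in> simplexes c P. apex c P \<notin> W} =
      (\<Sum>F\<in>{F \<in> nonempty_faces P. apex c P \<notin> F}. sum f (interior_simplexes c F))"
    unfolding simplexes_avoiding_apex_eq_Union_interior[OF P]
    using fin disj finite_nonempty_faces[OF P] by (intro sum.UNION_disjoint) simp_all
qed

lemma polytope_number_one: "apex_polytope c P \<Longrightarrow> polytope_number c P (Suc 0) = 1"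
  by (simp add: polytope_number.simps)

lemma polytope_number_rec:
  assumes "apex_polytope c P" "aff_dim P \<noteq> 0"
  shows "polytope_number c P (Suc (Suc m)) = polytope_number c P (Suc m)
    + (\<Sum>F\<in>{F \<in> nonempty_faces P. apex c P \<notin> F}. interior_polytope_number c F (Suc (Suc m)))"
  using assms by (subst polytope_number.simps) simp

lemma interior_polytope_number_eq:
  assumes "apex_polytope c P" "aff_dim P \<noteq> 0"
  shows "interior_polytope_number c P (Suc (Suc m)) = polytope_number c P (Suc (Suc m))
    - (\<Sum>F\<in>nonempty_faces P - {P}. interior_polytope_number c F (Suc (Suc m)))"
  using assms by (subst interior_polytope_number.simps) simp

text \<open>Both formulas are proved together by induction on the dimension, since each recursion
  calls interior numbers of proper faces.\<close>

lemma polytope_number_eq_sum_simplexes: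
  assumes "apex_polytope c P"
  shows "polytope_number c P (Suc (Suc m)) = (\<Sum>W\<in>simplexes c P. int (m choose (card W - 1))) \<and>
    interior_polytope_number c P (Suc (Suc m)) =
      (\<Sum>W\<in>interior_simplexes c P. int (m choose (card W - 1)))"
  using assms
proof (induction "nat (aff_dim P)" arbitrary: P m rule: less_induct)
  case less
  note P = less.prems
  let ?A = "{W \<in> simplexes c P. apex c P \<notin> W}"
  have IH: "interior_polytope_number c F (Suc (Suc m)) =
      (\<Sum>W\<in>interior_simplexes c F. int (m choose (card W - 1)))"
    if "F \<in> nonempty_faces P" "F \<noteq> P" for F m
    using less.hyps[OF nat_aff_dim_face_less[OF P that] apex_polytope_face[OF P that(1)]] by simp
  \<comment> \<open>Faces avoiding the apex are proper, so the induction hypothesis covers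
    them.\<close>
  have rec: "polytope_number c P (Suc (Suc m)) =
      polytope_number c P (Suc m) + (\<Sum>W\<in>?A. int (m choose (card W - 1)))"
    if "aff_dim P \<noteq> 0" for m
    unfolding polytope_number_rec[OF P that] sum_simplexes_eq_sum_faces(2)[OF P]
    using apex_mem[OF P] by (intro arg_cong2[where f = plus] refl sum.cong IH) auto
  \<comment> \<open>An inner induction on \<open>m\<close> telescopes \<open>rec\<close>. It starts
    at \<open>P(1) = 1\<close>, where \<open>0 choose card W\<close> vanishes, and its step is
    Pascal's rule.\<close>
  have number: "polytope_number c P (Suc m) = 1 + (\<Sum>W\<in>?A. int (m choose card W))" for m
  proof (cases "aff_dim P = 0")
    case True
    then obtain v where v: "P = {v}" using aff_dim_eq_0 by blast
    \<comment> \<open>The only nonempty subset of a single point contains the apex.\<close>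
    have "?A = {}"
      using apex_mem[OF P] apex_simplex_subset unfolding v simplexes_def by fastforce
    hence "(\<Sum>W\<in>?A. int (m choose card W)) = 0" by (simp only: sum.empty)
    moreover have "polytope_number c P (Suc m) = 1"
      using P True by (simp add: polytope_number.simps)
    ultimately show ?thesis by simp
  next
    case False
    have card: "\<exists>k. card W = Suc k" if "W \<in> ?A" for W
      using that card_simplex_pos[of W c P] gr0_implies_Suc by auto
    show ?thesis
    proof (induction m)
      case 0
      have "(\<Sum>W\<in>?A. int (0 choose card W)) = 0"
        by (rule sum.neutral) (use card in fastforce)
      thus ?case using polytope_number_one[OF P] by simp
    next
      case (Suc m)
      have "(\<Sum>W\<in>?A. int (Suc m choose card W)) =
          (\<Sum>W\<in>?A. int (m choose card W) + int (m choose (card W - 1)))"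
      proof (rule sum.cong)
        fix W assume "W \<in> ?A"
        from card[OF this] obtain k where "card W = Suc k" ..
        thus "int (Suc m choose card W) = int (m choose card W) + int (m choose (card W - 1))"
          by simp
      qed simp
      also have "\<dots> = (\<Sum>W\<in>?A. int (m choose card W)) + (\<Sum>W\<in>?A. int (m choose (card W - 1)))"
        by (rule sum.distrib)
      finally show ?case using rec[OF False] Suc.IH by simp
    qed
  qed
  \<comment> \<open>This is \<open>number\<close> at \<open>Suc m\<close>, rewritten by the pyramid
    identity.\<close>
  have 1: "polytope_number c P (Suc (Suc m)) = (\<Sum>W\<in>simplexes c P. int (m choose (card W - 1)))"
    unfolding number sum_simplexes_pyramid[OF P] ..
  \<comment> \<open>The term of \<open>P\<close> is split off; the induction hypothesis evaluates
    the proper faces.\<close>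
  have split: "(\<Sum>W\<in>simplexes c P. int (m choose (card W - 1))) =
      (\<Sum>W\<in>interior_simplexes c P. int (m choose (card W - 1)))
      + (\<Sum>F\<in>nonempty_faces P - {P}. interior_polytope_number c F (Suc (Suc m)))"
    unfolding sum_simplexes_eq_sum_faces(1)[OF P]
    by (subst sum.remove[OF finite_nonempty_faces[OF P] apex_polytope_self_face[OF P]])
      (simp add: IH)
  have 2: "interior_polytope_number c P (Suc (Suc m)) = polytope_number c P (Suc (Suc m))
    - (\<Sum>F\<in>nonempty_faces P - {P}. interior_polytope_number c F (Suc (Suc m)))"
  proof (cases "aff_dim P = 0")
    case True
    then obtain v where v: "P = {v}" using aff_dim_eq_0 by blast
    \<comment> \<open>A point has no proper nonempty face, so its interior and polytope numbers
      agree.\<close>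
    hence proper: "nonempty_faces P - {P} = {}"
      using face_of_imp_subset unfolding nonempty_faces_def by blast
    show ?thesis
      unfolding proper using P True
      by (simp add: polytope_number.simps interior_polytope_number.simps[of c P])
  qed (rule interior_polytope_number_eq[OF P])
  show ?case using 1 2 split by linarith
qed

section \<open>Chains of faces\<close>

text \<open>Splits the condition on indices into index \<open>0\<close> and the successors, for use
  in list induction.\<close>

lemma pointed_chain_Cons:
  "pointed_chain c P (G # Gs) \<longleftrightarrow> G \<in> nonempty_faces P \<and> pointed_chain c P Gs
    \<and> (Gs \<noteq> [] \<longrightarrow> hd Gs \<subset> G \<and> apex c G \<notin> hd Gs)"
proof (cases Gs)
  case (Cons G' Gs')
  have "(\<forall>i. Suc i < length (G # Gs) \<longrightarrow> Q i) \<longleftrightarrow> Q 0 \<and> (\<forall>i. Suc i < length Gs \<longrightarrow> Q (Suc i))"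
    for Q
  proof (intro iffI allI impI conjI)
    fix i assume "Q 0 \<and> (\<forall>i. Suc i < length Gs \<longrightarrow> Q (Suc i))" "Suc i < length (G # Gs)"
    thus "Q i" by (cases i) auto
  qed (auto simp: Cons)
  from this[of "\<lambda>i. (G # Gs) ! Suc i \<subset> (G # Gs) ! i \<and> apex c ((G # Gs) ! i) \<notin> (G # Gs) ! Suc i"]
  show ?thesis unfolding pointed_chain_def using Cons by auto
qed (auto simp: pointed_chain_def)

lemma pointed_chain_subset_hd:
  "pointed_chain c P Gs \<Longrightarrow> F \<in> set Gs \<Longrightarrow> F \<subseteq> hd Gs"
proof (induction Gs)
  case (Cons G Gs)
  thus ?case by (cases "Gs = []") (auto simp: pointed_chain_Cons)
qed simp

text \<open>All later faces of the chain are faces of the second one, which serves as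
  \<open>H\<close>; for a one-element chain \<open>H\<close> is empty.\<close>

lemma pointed_chain_imp_apex_simplex:
  "apex_polytope c P \<Longrightarrow> pointed_chain c P Gs \<Longrightarrow> apex_simplex c P (apex c ` set Gs)"
proof (induction Gs arbitrary: P)
  case Nil
  show ?case by (simp add: apex_simplex.empty)
next
  case (Cons G Gs)
  have G: "G \<in> nonempty_faces P" and Gs: "pointed_chain c P Gs"
    and hd: "Gs \<noteq> [] \<Longrightarrow> hd Gs \<subset> G \<and> apex c G \<notin> hd Gs"
    using Cons.prems(2) by (auto simp: pointed_chain_Cons)
  have faceG: "G face_of P" "apex_polytope c G"
    using G apex_polytope_face[OF Cons.prems(1)] by (auto simp: nonempty_faces_def)
  show ?case
  proof (cases "Gs = []")
    case True
    thus ?thesis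
      using apex_simplex.insert[OF faceG(2,1), of "{}" "{}"] by (simp add: apex_simplex.empty)
  next
    case False
    let ?H = "hd Gs"
    have H: "?H \<in> nonempty_faces P"
      using Gs hd_in_set[OF False] unfolding pointed_chain_def by blast
    hence faceH: "?H face_of P" by (simp add: nonempty_faces_def)
    have "set Gs \<subseteq> nonempty_faces ?H"
      using pointed_chain_subset_hd[OF Gs] Gs
      by (auto simp: pointed_chain_def nonempty_faces_def face_of_face[OF faceH])
    hence "pointed_chain c ?H Gs" using Gs unfolding pointed_chain_def by blast
    hence "apex_simplex c ?H (apex c ` set Gs)"
      using Cons.IH[OF apex_polytope_face[OF Cons.prems(1) H]] by simp
    moreover have "?H face_of G" using faceH hd[OF False] face_of_face[OF faceG(1)] by blast
    ultimately show ?thesis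
      using apex_simplex.insert[OF faceG(2,1)] hd[OF False] by simp
  qed
qed

text \<open>The apex of \<open>G\<close> is outside \<open>H\<close>, hence outside
  \<open>W\<close>: each face contributes a new vertex, so length and cardinality agree.\<close>

lemma apex_simplex_imp_pointed_chain:
  "apex_simplex c P W \<Longrightarrow> \<exists>Gs. pointed_chain c P Gs \<and> W = apex c ` set Gs \<and> length Gs = card W"
proof (induction rule: apex_simplex.induct)
  case (empty P)
  show ?case by (auto simp: pointed_chain_def)
next
  case (insert G P H W)
  from insert.IH obtain Gs
    where Gs: "pointed_chain c H Gs" "W = apex c ` set Gs" "length Gs = card W"
    by blast
  have "H face_of P" using insert.hyps(3,2) by (rule face_of_trans)
  have "H \<subseteq> G" using insert.hyps(3) by (rule face_of_imp_subset)
  have sub: "set Gs \<subseteq> nonempty_faces H" using Gs(1) unfolding pointed_chain_def by blast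
  have "nonempty_faces H \<subseteq> nonempty_faces P"
    using face_of_trans[OF _ \<open>H face_of P\<close>] by (auto simp: nonempty_faces_def)
  hence "pointed_chain c P Gs"
    using Gs(1) by (auto simp: pointed_chain_def)
  \<comment> \<open>The head lies in \<open>H\<close>, which misses the apex of \<open>G\<close>;
    this also makes the inclusion strict.\<close>
  moreover have "hd Gs \<subset> G \<and> apex c G \<notin> hd Gs" if "Gs \<noteq> []"
  proof -
    have "hd Gs \<in> nonempty_faces H" using hd_in_set[OF that] sub by blast
    hence "hd Gs \<subseteq> H" by (simp add: nonempty_faces_def face_of_imp_subset)
    thus ?thesis using \<open>H \<subseteq> G\<close> insert.hyps(4) apex_mem[OF insert.hyps(1)] by blast
  qed
  moreover have "G \<in> nonempty_faces P"
    using insert.hyps(1,2) by (simp add: nonempty_faces_def apex_polytope_def)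
  ultimately have "pointed_chain c P (G # Gs)" by (simp add: pointed_chain_Cons)
  moreover have "apex c G \<notin> W"
    using apex_simplex_subset[OF insert.hyps(5)] insert.hyps(4) by blast
  moreover have "finite W" using Gs(2) by simp
  ultimately show ?case using Gs(2,3) by (intro exI[of _ "G # Gs"]) simp
qed

text \<open>By affine independence; it supplies the length bound in
  \<open>pointed_triangulation\<close>.\<close>

lemma card_apex_simplex:
  assumes "apex_simplex c P W"
  shows "int (card W) \<le> aff_dim P + 1"
  using aff_dim_affine_independent[OF apex_simplex_affine_independent[OF assms]]
    aff_dim_subset[OF apex_simplex_subset[OF assms]] by simp

lemma pointed_triangulation_eq:
  assumes P: "apex_polytope c P"
  shows "pointed_triangulation c P = insert {} ((hull) convex ` simplexes c P)"
proof -
  have "(\<exists>Gs. 1 \<le> length Gs \<and> int (length Gs) \<le> aff_dim P + 1 \<and> pointed_chain c P Gs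
      \<and> W = apex c ` set Gs) \<longleftrightarrow> W \<in> simplexes c P" (is "?L \<longleftrightarrow> ?R") for W
  proof
    assume ?L
    thus ?R using pointed_chain_imp_apex_simplex[OF P] by (auto simp: simplexes_def)
  next
    assume R: ?R
    then obtain Gs where "pointed_chain c P Gs" "W = apex c ` set Gs" "length Gs = card W"
      using apex_simplex_imp_pointed_chain[of c P W] unfolding simplexes_def by auto
    moreover have "int (card W) \<le> aff_dim P + 1" "1 \<le> card W"
      using R card_apex_simplex[of c P W] card_simplex_pos[OF R] by (simp_all add: simplexes_def)
    ultimately show ?L by (intro exI[of _ Gs]) simp
  qed
  hence "simplexes c P = {apex c ` set Gs |Gs.
      1 \<le> length Gs \<and> int (length Gs) \<le> aff_dim P + 1 \<and> pointed_chain c P Gs}"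
    by blast
  thus ?thesis by (simp add: pointed_triangulation_def setcompr_eq_image image_image)
qed

section \<open>Counting simplexes by dimension\<close>

text \<open>The vertices are recovered as the extreme points of the hull.\<close>

lemma affine_independent_convex_hull_inject:
  fixes V W :: "'a::euclidean_space set"
  assumes "\<not> affine_dependent V" "\<not> affine_dependent W" "convex hull V = convex hull W"
  shows "V = W"
proof (rule set_eqI)
  fix x
  show "x \<in> V \<longleftrightarrow> x \<in> W"
    using extreme_point_of_convex_hull_affine_independent[OF assms(1), of x]
      extreme_point_of_convex_hull_affine_independent[OF assms(2), of x] assms(3) by simp
qed

lemma num_simplexes_eq:
  fixes P :: "'a::euclidean_space set"
  assumes P: "apex_polytope c P"
  shows "num_simplexes c P k = card {W \<in> simplexes c P. card W = Suc k}"
proof -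
  have ind: "\<not> affine_dependent W" if "W \<in> simplexes c P" for W
    using that by (auto simp: simplexes_def dest: apex_simplex_affine_independent)
  have simplex_iff: "int k simplex (convex hull W) \<longleftrightarrow> card W = Suc k" if "W \<in> simplexes c P" for W
  proof
    assume "int k simplex (convex hull W)"
    then obtain C where C: "\<not> affine_dependent C" "int (card C) = int k + 1"
      "convex hull W = convex hull C" unfolding simplex_def by blast
    have "W = C" using ind[OF that] C(1,3) by (rule affine_independent_convex_hull_inject)
    with C(2) show "card W = Suc k" by simp
  next
    assume "card W = Suc k"
    thus "int k simplex (convex hull W)"
      unfolding simplex_def using ind[OF that] by (intro exI[of _ W]) simp
  qed
  \<comment> \<open>The empty simplex has dimension \<open>-1\<close>, so no natural
    \<open>k\<close> counts it.\<close>
  have "\<not> int k simplex ({} :: 'a set)"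
  proof
    assume "int k simplex ({} :: 'a set)"
    then obtain C :: "'a set" where "convex hull C = {}" "int (card C) = int k + 1"
      unfolding simplex_def by metis
    thus False by simp
  qed
  hence "{S \<in> pointed_triangulation c P. int k simplex S} =
      (hull) convex ` {W \<in> simplexes c P. card W = Suc k}"
    unfolding pointed_triangulation_eq[OF P] using simplex_iff by auto
  moreover have "inj_on ((hull) convex) {W \<in> simplexes c P. card W = Suc k}"
    by (rule inj_onI, rule affine_independent_convex_hull_inject) (use ind in auto)
  ultimately show ?thesis
    unfolding num_simplexes_def by (simp add: card_image)
qed

text \<open>For \<open>k \<le> m\<close> the upper index simplifies to \<open>m\<close>; for
  \<open>k > m\<close> the argument is at most \<open>0\<close> and both sides vanish.\<close>

lemma simplex_number_eq_choose:
  "simplex_number k (int (Suc (Suc m)) - (int k + 1)) = int (m choose k)"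
proof (cases "k \<le> m")
  case True
  hence "nat (int (Suc (Suc m)) - (int k + 1) + int k - 1) = m" by simp
  with True show ?thesis by (simp add: simplex_number_def)
qed (simp add: simplex_number_def)

theorem theorem4p5:
  fixes P :: "'a::euclidean_space set" and c :: 'a and d n :: nat
  assumes "polytope P" and "aff_dim P = int d"
    and "separates_vertices c P"
    and "n \<noteq> 1"
  shows "polytope_number c P n =
           (\<Sum>k = 0..d. int (num_simplexes c P k) * simplex_number k (int n - (int k + 1)))"
proof (cases "n = 0")
  \<comment> \<open>Every argument \<open>-(k + 1)\<close> is negative, so all terms are
    \<open>0\<close>.\<close>
  case True
  thus ?thesis by (simp add: polytope_number.simps simplex_number_def)
next
  case False
  \<comment> \<open>With \<open>n = 1\<close> excluded, \<open>n\<close> is at least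
    \<open>2\<close> here.\<close>
  define m where "m = n - 2"
  have n: "n = Suc (Suc m)" using False assms(4) m_def by simp
  have P: "apex_polytope c P" using assms by (auto simp: apex_polytope_def)
  have card: "card W - 1 \<in> {0..d}" "0 < card W" if "W \<in> simplexes c P" for W
    using that card_apex_simplex[of c P W] card_simplex_pos[OF that] assms(2)
    by (auto simp: simplexes_def)
  have "polytope_number c P n = (\<Sum>W\<in>simplexes c P. int (m choose (card W - 1)))"
    using polytope_number_eq_sum_simplexes[OF P] n by simp
  \<comment> \<open>Group the simplexes by dimension; the summand is constant on each group.\<close>
  also have "\<dots> = (\<Sum>k = 0..d. \<Sum>W\<in>{W \<in> simplexes c P. card W - 1 = k}. int (m choose (card W - 1)))"
    by (rule sum.group[symmetric]) (use finite_simplexes[OF P] card in auto)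
  also have "\<dots> = (\<Sum>k = 0..d. int (num_simplexes c P k) * simplex_number k (int n - (int k + 1)))"
  proof (rule sum.cong)
    fix k
    have "{W \<in> simplexes c P. card W - 1 = k} = {W \<in> simplexes c P. card W = Suc k}"
    proof (rule Collect_cong, rule conj_cong[OF refl])
      fix W assume "W \<in> simplexes c P"
      from card(2)[OF this] show "(card W - 1 = k) = (card W = Suc k)" by auto
    qed
    thus "(\<Sum>W\<in>{W \<in> simplexes c P. card W - 1 = k}. int (m choose (card W - 1))) =
        int (num_simplexes c P k) * simplex_number k (int n - (int k + 1))"
      unfolding n simplex_number_eq_choose num_simplexes_eq[OF P] by simp
  qed simp
  finally show ?thesis .
qed

end
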